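(* (i) Let $G$ be a convex bounded domain in $\mathbb{C}$. Then $\mathbf{r}(G)\ge 1$. (ii) Let $G\ne\mathbb{C}$ be a convex domain in $\mathbb{C}$ that is not bounded. Then $\mathbf{r}_a(G)\ge 1$.
   Context: A domain is a nonempty connected open set. $\Pi=\{s\in\mathbb{C}:\Re s>0\}$ and $\Pi_{\sigma}=\{s\in\mathbb{C}:\Re s>\sigma\}$ for real $\sigma$. $H^\infty(\Pi)$ is the space of bounded holomorphic functions on $\Pi$. Rogosinski abscissa: for a domain $G\subset\mathbb{C}$, $\mathbf{r}(G)$ is the infimum of those real $\sigma'\ge 0$ such that for every $f\in H^\infty(\Pi)$ with $f(\Pi)\subset G$ that is represented in $\Pi$ by a convergent ordinary Dirichlet series $f(s)=\sum_{n=1}^\infty a_n n^{-s}$, every partial sum $P_k(s)=\sum_{n=1}^k a_n n^{-s}$ ($k\ge 1$) satisfies $P_k(\Pi_{\sigma'})\subset G$. The quantity $\mathbf{r}_a(G)$ is defined in the same way, except that only those $f$ are considered whose Dirichlet series converges absolutely at every point of $\Pi$. *)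

theory Defs
  imports "HOL-Complex_Analysis.Complex_Analysis" "HOL-Library.Extended_Real"
begin

definition is_domain :: "complex set \<Rightarrow> bool" where
  "is_domain G \<longleftrightarrow> G \<noteq> {} \<and> open G \<and> connected G"

definition half_plane :: "real \<Rightarrow> complex set" where
  "half_plane \<sigma> = {s. Re s > \<sigma>}"

definition H_infinity :: "(complex \<Rightarrow> complex) set" where
  "H_infinity = {f. f holomorphic_on half_plane 0 \<and> bounded (f ` half_plane 0)}"

text \<open>Dirichlet series are indexed from 1; the value of the coefficient sequence at 0 is never used.\<close>

definition dirichlet_term :: "(nat \<Rightarrow> complex) \<Rightarrow> complex \<Rightarrow> nat \<Rightarrow> complex" where
  "dirichlet_term a s n = a n * of_nat n powr (- s)"

definition dirichlet_partial_sum :: "(nat \<Rightarrow> complex) \<Rightarrow> nat \<Rightarrow> complex \<Rightarrow> complex" where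
  "dirichlet_partial_sum a k s = (\<Sum>n=1..k. dirichlet_term a s n)"

definition dirichlet_represents :: "(nat \<Rightarrow> complex) \<Rightarrow> (complex \<Rightarrow> complex) \<Rightarrow> bool" where
  "dirichlet_represents a f \<longleftrightarrow>
     (\<forall>s \<in> half_plane 0. (\<lambda>n. dirichlet_term a s (Suc n)) sums f s)"

definition dirichlet_abs_convergent :: "(nat \<Rightarrow> complex) \<Rightarrow> bool" where
  "dirichlet_abs_convergent a \<longleftrightarrow>
     (\<forall>s \<in> half_plane 0. summable (\<lambda>n. norm (dirichlet_term a s (Suc n))))"

text \<open>The infimum is taken in the extended reals, so it is \<open>\<infinity>\<close> if no real \<open>\<sigma>\<close> is admissible.\<close>

definition rogosinski_abscissa :: "complex set \<Rightarrow> ereal" where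
  "rogosinski_abscissa G =
     Inf (ereal ` {\<sigma>. 0 \<le> \<sigma> \<and>
       (\<forall>f a. f \<in> H_infinity \<and> f ` half_plane 0 \<subseteq> G \<and> dirichlet_represents a f \<longrightarrow>
          (\<forall>k\<ge>1. dirichlet_partial_sum a k ` half_plane \<sigma> \<subseteq> G))})"

definition rogosinski_abscissa_abs :: "complex set \<Rightarrow> ereal" where
  "rogosinski_abscissa_abs G =
     Inf (ereal ` {\<sigma>. 0 \<le> \<sigma> \<and>
       (\<forall>f a. f \<in> H_infinity \<and> f ` half_plane 0 \<subseteq> G \<and> dirichlet_represents a f \<and>
              dirichlet_abs_convergent a \<longrightarrow>
          (\<forall>k\<ge>1. dirichlet_partial_sum a k ` half_plane \<sigma> \<subseteq> G))})"

end

theory Submission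
  imports Defs
begin

text \<open>
  The substitution \<open>z = 2\<^sup>-\<^sup>s\<close> maps the right half-plane into the unit disc, so a power series
  \<open>\<Sum> c\<^sub>m z\<^sup>m\<close> on the disc becomes a Dirichlet series supported on the powers of \<open>2\<close>, whose second
  partial sum is the linear polynomial \<open>c\<^sub>0 + c\<^sub>1 2\<^sup>-\<^sup>s\<close>. The bound \<open>\<sigma> \<ge> 1\<close> is therefore the
  classical bound \<open>2\<^sup>-\<^sup>\<sigma> \<le> 1/2\<close> for Rogosinski's radius, and the extremal functions are the same:
  the disc automorphisms \<open>(z + t) / (1 + t z)\<close> with \<open>0 < t < 1\<close>. The first-order section of this
  function is \<open>t + (1 - t\<^sup>2) z\<close>, which equals \<open>1\<close> at \<open>z = 1 / (1 + t)\<close>. As \<open>t\<close> varies, these points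
  fill the whole interval between \<open>1/2\<close> and \<open>1\<close>.

  The passage from the disc to \<open>G\<close> uses a disc \<open>ball w (dist w p)\<close> inside \<open>G\<close> with \<open>p\<close> a nearest
  point to \<open>w\<close> of the complement. The affine map that takes \<open>0\<close> to \<open>w\<close> and \<open>1\<close> to \<open>p\<close> carries the
  unit disc onto it, so composing gives a function with values in \<open>G\<close> that has a section through
  \<open>p \<notin> G\<close>. These functions are bounded and have absolutely convergent series, so they are admissible
  for both abscissas.
\<close>

definition dyadic_coeffs :: "(nat \<Rightarrow> complex) \<Rightarrow> nat \<Rightarrow> complex" where
  "dyadic_coeffs c n = (if n \<in> range (\<lambda>m. 2 ^ m) then c (inv (\<lambda>m. 2 ^ m) n) else 0)"

lemma inj_two_power: "inj (\<lambda>m. 2 ^ m :: nat)"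
  by (auto intro: injI)

lemma dyadic_coeffs_two_power: "dyadic_coeffs c (2 ^ m) = c m"
  using inv_f_f[OF inj_two_power, of m] by (auto simp: dyadic_coeffs_def)

lemma two_power_powr: "of_nat (2 ^ m) powr (- s) = (2 powr (- s) :: complex) ^ m"
proof (induction m)
  case (Suc m)
  have "of_nat (2 ^ Suc m) powr (- s) = (of_real 2 * of_real (2 ^ m)) powr (- s)"
    by simp
  also have "\<dots> = of_real 2 powr (- s) * of_real (2 ^ m) powr (- s)"
    by (rule powr_times_real) auto
  finally show ?case using Suc by simp
qed auto

lemma norm_two_powr_less_one:
  assumes "s \<in> half_plane 0"
  shows "norm (2 powr (- s) :: complex) < 1"
proof -
  have "norm (of_real 2 powr (- s) :: complex) = 2 powr Re (- s)"
    by (subst norm_powr_real_powr) auto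
  moreover have "(2::real) powr Re (- s) < 1"
    using assms by (simp add: half_plane_def powr_less_one)
  ultimately show ?thesis by simp
qed

lemma dirichlet_term_dyadic:
  "dirichlet_term (dyadic_coeffs c) s (2 ^ m) = c m * (2 powr (- s)) ^ m"
  by (simp add: dirichlet_term_def dyadic_coeffs_two_power two_power_powr del: of_nat_power)

text \<open>The coefficient of \<open>z\<^sup>m\<close> sits at \<open>2\<^sup>m\<close>, which is position \<open>2\<^sup>m - 1\<close> of a series whose terms are
  counted from \<open>0\<close>. Summing along this subsequence turns the Dirichlet series into the power
  series.\<close>

lemma strict_mono_two_power_minus_one: "strict_mono (\<lambda>m. 2 ^ m - 1 :: nat)"
  by (intro strict_monoI diff_less_mono) simp_all

lemma dirichlet_term_dyadic_eq_0:
  assumes "n \<notin> range (\<lambda>m. 2 ^ m - 1)"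
  shows "dirichlet_term (dyadic_coeffs c) s (Suc n) = 0"
proof -
  have "n = 2 ^ m - 1" if "Suc n = 2 ^ m" for m
    by (simp flip: that)
  then have "Suc n \<notin> range (\<lambda>m. 2 ^ m)"
    using assms by blast
  then show ?thesis by (simp add: dirichlet_term_def dyadic_coeffs_def)
qed

lemma dirichlet_represents_dyadic:
  assumes "\<And>z. norm z < 1 \<Longrightarrow> (\<lambda>m. c m * z ^ m) sums g z"
  shows "dirichlet_represents (dyadic_coeffs c) (\<lambda>s. g (2 powr (- s)))"
  unfolding dirichlet_represents_def
proof
  fix s assume s: "s \<in> half_plane 0"
  let ?T = "\<lambda>n. dirichlet_term (dyadic_coeffs c) s (Suc n)"
  have "(\<lambda>m. ?T (2 ^ m - 1)) sums g (2 powr (- s))"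
    using assms[OF norm_two_powr_less_one[OF s]] by (simp add: dirichlet_term_dyadic)
  then show "?T sums g (2 powr (- s))"
    using sums_mono_reindex[OF strict_mono_two_power_minus_one, of ?T]
      dirichlet_term_dyadic_eq_0 by blast
qed

lemma dirichlet_abs_convergent_dyadic:
  assumes "\<And>z. norm z < 1 \<Longrightarrow> summable (\<lambda>m. norm (c m * z ^ m))"
  shows "dirichlet_abs_convergent (dyadic_coeffs c)"
  unfolding dirichlet_abs_convergent_def
proof
  fix s assume s: "s \<in> half_plane 0"
  let ?T = "\<lambda>n. norm (dirichlet_term (dyadic_coeffs c) s (Suc n))"
  have "summable (\<lambda>m. ?T (2 ^ m - 1))"
    using assms[OF norm_two_powr_less_one[OF s]] by (simp add: dirichlet_term_dyadic)
  then show "summable ?T"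
    using summable_mono_reindex[OF strict_mono_two_power_minus_one, of ?T]
      dirichlet_term_dyadic_eq_0 by (metis norm_zero)
qed

lemma dirichlet_partial_sum_dyadic_2:
  "dirichlet_partial_sum (dyadic_coeffs c) 2 s = c 0 + c 1 * 2 powr (- s)"
proof -
  have "{1..2} = {2 ^ 0, 2 ^ 1 :: nat}" by auto
  then have "dirichlet_partial_sum (dyadic_coeffs c) 2 s =
      dirichlet_term (dyadic_coeffs c) s (2 ^ 0) + dirichlet_term (dyadic_coeffs c) s (2 ^ 1)"
    by (simp add: dirichlet_partial_sum_def)
  then show ?thesis by (simp only: dirichlet_term_dyadic) simp
qed

text \<open>The Taylor coefficients at \<open>0\<close> of \<open>(z + t) / (1 + t z) = t + (1 - t\<^sup>2) z / (1 + t z)\<close>, expanded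
  as a geometric series in \<open>- t z\<close>.\<close>

definition moebius_coeffs :: "real \<Rightarrow> nat \<Rightarrow> complex" where
  "moebius_coeffs t n = (case n of 0 \<Rightarrow> of_real t | Suc m \<Rightarrow> of_real (1 - t\<^sup>2) * (- of_real t) ^ m)"

lemma moebius_sums:
  assumes "0 < t" "t < 1" "norm z < 1"
  shows "(\<lambda>m. moebius_coeffs t m * z ^ m) sums Moebius_function 0 (- of_real t) z"
proof -
  have lt: "norm (- of_real t * z) < 1"
    using assms mult_strict_mono[of t 1 "norm z" 1] by (simp add: norm_mult)
  have nz: "1 + of_real t * z \<noteq> 0"
  proof
    assume "1 + of_real t * z = 0"
    then have "- of_real t * z = 1" by (simp add: add_eq_0_iff)
    then show False using lt by (simp only: norm_one)
  qed
  let ?S = "of_real (1 - t\<^sup>2) * z * (1 / (1 - (- of_real t * z)))"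
  have "(\<lambda>m. of_real (1 - t\<^sup>2) * z * (- of_real t * z) ^ m) sums ?S"
    by (intro sums_mult geometric_sums lt)
  moreover have "moebius_coeffs t (Suc m) * z ^ Suc m =
      of_real (1 - t\<^sup>2) * z * (- of_real t * z) ^ m" for m
    unfolding moebius_coeffs_def power_mult_distrib nat.case power_Suc by (simp only: ac_simps)
  ultimately have "(\<lambda>m. moebius_coeffs t (Suc m) * z ^ Suc m) sums ?S"
    by (simp only:)
  then have "(\<lambda>m. moebius_coeffs t m * z ^ m) sums (?S + moebius_coeffs t 0 * z ^ 0)"
    by (rule sums_Suc)
  moreover have "?S + moebius_coeffs t 0 * z ^ 0 = Moebius_function 0 (- of_real t) z"
  proof -
    have "?S + moebius_coeffs t 0 * z ^ 0 =
        ((1 - (of_real t)\<^sup>2) * z + of_real t * (1 + of_real t * z)) / (1 + of_real t * z)"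
      using nz by (simp add: moebius_coeffs_def add_divide_distrib)
    also have "(1 - (of_real t)\<^sup>2) * z + of_real t * (1 + of_real t * z) = z + of_real t"
      by (simp add: algebra_simps power2_eq_square)
    finally show ?thesis by (simp add: Moebius_function_def)
  qed
  ultimately show ?thesis by simp
qed

lemma moebius_abs_summable:
  assumes "0 < t" "t < 1" "norm z < 1"
  shows "summable (\<lambda>m. norm (moebius_coeffs t m * z ^ m))"
proof -
  \<comment> \<open>A power series converges absolutely strictly inside any disc on which it converges.\<close>
  obtain r where r: "norm z < r" "r < 1"
    using assms(3) dense by blast
  then have "norm (of_real r :: complex) < 1" "norm z < norm (of_real r :: complex)"
    using norm_ge_zero[of z] by (simp_all del: norm_ge_zero)
  then show ?thesis
    using moebius_sums[OF assms(1,2)] powser_insidea sums_summable by blast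
qed

text \<open>For \<open>z = 2\<^sup>-\<^sup>s\<close> with real \<open>s\<close> between \<open>\<sigma>\<close> and \<open>1\<close>, the choice \<open>t = 1 / z - 1\<close> makes
  \<open>t + (1 - t\<^sup>2) z = t + (1 - t) = 1\<close>; this \<open>t\<close> lies strictly between \<open>0\<close> and \<open>1\<close>
  because \<open>1/2 < z < 1\<close>, and \<open>z > 1/2\<close> is where \<open>\<sigma> < 1\<close> enters.\<close>

lemma partial_sum_leaves:
  assumes G: "open G" "G \<noteq> {}" "G \<noteq> UNIV" and \<sigma>: "0 \<le> \<sigma>" "\<sigma> < 1"
  shows "\<exists>f a. f \<in> H_infinity \<and> f ` half_plane 0 \<subseteq> G \<and> dirichlet_represents a f \<and>
           dirichlet_abs_convergent a \<and> \<not> dirichlet_partial_sum a 2 ` half_plane \<sigma> \<subseteq> G"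
proof -
  obtain w where w: "w \<in> G" using G by auto
  obtain p where p: "p \<in> - G" "\<And>y. y \<in> - G \<Longrightarrow> dist w p \<le> dist w y"
    using distance_attains_inf[of "- G" w] G by (auto simp: closed_Compl)
  have ball: "ball w (dist w p) \<subseteq> G"
    using p(2) by (metis ComplI mem_ball not_le subsetI)
  have "p \<noteq> w" using w p by auto

  obtain x where x: "\<sigma> < x" "x < 1" using \<sigma> dense by blast
  define \<zeta> where "\<zeta> = (2::real) powr (- x)"
  have \<zeta>: "1 / 2 < \<zeta>" "\<zeta> < 1"
  proof -
    have "(2::real) powr (- 1) < 2 powr (- x)" using x by (intro powr_less_mono) auto
    then show "1 / 2 < \<zeta>" by (simp add: \<zeta>_def powr_minus_divide)
    show "\<zeta> < 1" using x \<sigma> by (simp add: \<zeta>_def powr_less_one)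
  qed
  define t where "t = 1 / \<zeta> - 1"
  have t: "0 < t" "t < 1" using \<zeta> by (auto simp: t_def field_simps)
  have \<zeta>_complex: "2 powr (- of_real x) = (of_real \<zeta> :: complex)"
    using powr_of_real[of 2 "- x"] by (simp add: \<zeta>_def)

  define g where "g = (\<lambda>z. w + (p - w) * Moebius_function 0 (- of_real t) z)"
  define c where "c = (\<lambda>m. (if m = 0 then w else 0) + (p - w) * moebius_coeffs t m)"
  define f where "f = (\<lambda>s. g (2 powr (- s)))"

  have c_term: "c m * z ^ m = (if m = 0 then w else 0) + (p - w) * (moebius_coeffs t m * z ^ m)"
    for m z by (simp add: c_def algebra_simps)
  have sums: "(\<lambda>m. c m * z ^ m) sums g z" if "norm z < 1" for z
    unfolding c_term g_def
    using sums_single[of 0 "\<lambda>_. w"]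
    by (intro sums_add sums_mult moebius_sums t that) simp
  have abs: "summable (\<lambda>m. norm (c m * z ^ m))" if "norm z < 1" for z
  proof (rule summable_comparison_test')
    show "summable (\<lambda>m. norm (if m = 0 then w else 0)
        + norm (p - w) * norm (moebius_coeffs t m * z ^ m))"
      by (intro summable_add summable_mult moebius_abs_summable t that
          summable_finite[of "{0}"]) auto
    show "norm (norm (c m * z ^ m)) \<le> norm (if m = 0 then w else 0)
        + norm (p - w) * norm (moebius_coeffs t m * z ^ m)" for m
      unfolding c_term real_norm_def abs_norm_cancel norm_mult[symmetric] by (rule norm_triangle_ineq)
  qed

  have range: "f s \<in> ball w (dist w p)" if "s \<in> half_plane 0" for s
  proof -
    have "norm (Moebius_function 0 (- of_real t) (2 powr (- s))) < 1"
      using t norm_two_powr_less_one[OF that] by (intro Moebius_function_norm_lt_1) auto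
    then show ?thesis
      using \<open>p \<noteq> w\<close> by (simp add: f_def g_def dist_norm norm_mult norm_minus_commute)
  qed
  have "Moebius_function 0 (- of_real t) holomorphic_on ball 0 1"
    using t by (intro Moebius_function_holomorphic) auto
  then have "(Moebius_function 0 (- of_real t) \<circ> (\<lambda>s. 2 powr (- s))) holomorphic_on half_plane 0"
    using norm_two_powr_less_one
    by (intro holomorphic_on_compose_gen[where t = "ball 0 1"] holomorphic_intros) auto
  then have "f holomorphic_on half_plane 0"
    unfolding f_def g_def o_def by (intro holomorphic_intros)
  moreover have "bounded (f ` half_plane 0)"
    using range by (intro bounded_subset[OF bounded_ball[of w "dist w p"]]) auto
  ultimately have "f \<in> H_infinity" by (simp add: H_infinity_def)
  moreover have "f ` half_plane 0 \<subseteq> G" using range ball by auto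
  moreover have "dirichlet_represents (dyadic_coeffs c) f"
    unfolding f_def by (rule dirichlet_represents_dyadic) (rule sums)
  moreover have "dirichlet_abs_convergent (dyadic_coeffs c)"
    by (rule dirichlet_abs_convergent_dyadic) (rule abs)
  moreover have "dirichlet_partial_sum (dyadic_coeffs c) 2 (of_real x) = p"
  proof -
    have "t + (1 - t\<^sup>2) * \<zeta> = 1"
      using \<zeta> by (simp add: t_def field_simps power2_eq_square)
    then have 1: "of_real t + of_real (1 - t\<^sup>2) * of_real \<zeta> = (1::complex)"
      by (metis of_real_1 of_real_add of_real_mult)
    have "dirichlet_partial_sum (dyadic_coeffs c) 2 (of_real x) =
        w + (p - w) * (of_real t + of_real (1 - t\<^sup>2) * of_real \<zeta>)"
      unfolding dirichlet_partial_sum_dyadic_2 \<zeta>_complex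
      by (simp add: c_def moebius_coeffs_def algebra_simps)
    then show ?thesis unfolding 1 by simp
  qed
  then have "\<not> dirichlet_partial_sum (dyadic_coeffs c) 2 ` half_plane \<sigma> \<subseteq> G"
    using p(1) x by (force simp: half_plane_def)
  ultimately show ?thesis by blast
qed

lemma one_le_rogosinski_abscissa:
  assumes "open G" "G \<noteq> {}" "G \<noteq> UNIV"
  shows "1 \<le> rogosinski_abscissa G"
  unfolding rogosinski_abscissa_def
proof (rule INF_greatest, rule ccontr)
  fix \<sigma> assume \<sigma>: "\<sigma> \<in> {\<sigma>. 0 \<le> \<sigma> \<and>
       (\<forall>f a. f \<in> H_infinity \<and> f ` half_plane 0 \<subseteq> G \<and> dirichlet_represents a f \<longrightarrow>
          (\<forall>k\<ge>1. dirichlet_partial_sum a k ` half_plane \<sigma> \<subseteq> G))}"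
    and "\<not> 1 \<le> ereal \<sigma>"
  then have "\<sigma> < 1" "0 \<le> \<sigma>" by auto
  then obtain f a where "f \<in> H_infinity" "f ` half_plane 0 \<subseteq> G" "dirichlet_represents a f"
      "dirichlet_abs_convergent a" "\<not> dirichlet_partial_sum a 2 ` half_plane \<sigma> \<subseteq> G"
    using partial_sum_leaves[OF assms] by blast
  moreover have "(1::nat) \<le> 2" by simp
  ultimately show False using \<sigma> by blast
qed

lemma one_le_rogosinski_abscissa_abs:
  assumes "open G" "G \<noteq> {}" "G \<noteq> UNIV"
  shows "1 \<le> rogosinski_abscissa_abs G"
  unfolding rogosinski_abscissa_abs_def
proof (rule INF_greatest, rule ccontr)
  fix \<sigma> assume \<sigma>: "\<sigma> \<in> {\<sigma>. 0 \<le> \<sigma> \<and>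
       (\<forall>f a. f \<in> H_infinity \<and> f ` half_plane 0 \<subseteq> G \<and> dirichlet_represents a f \<and>
              dirichlet_abs_convergent a \<longrightarrow>
          (\<forall>k\<ge>1. dirichlet_partial_sum a k ` half_plane \<sigma> \<subseteq> G))}"
    and "\<not> 1 \<le> ereal \<sigma>"
  then have "\<sigma> < 1" "0 \<le> \<sigma>" by auto
  then obtain f a where "f \<in> H_infinity" "f ` half_plane 0 \<subseteq> G" "dirichlet_represents a f"
      "dirichlet_abs_convergent a" "\<not> dirichlet_partial_sum a 2 ` half_plane \<sigma> \<subseteq> G"
    using partial_sum_leaves[OF assms] by blast
  moreover have "(1::nat) \<le> 2" by simp
  ultimately show False using \<sigma> by blast
qed

theorem theorem3p3:
  "(\<forall>G::complex set. is_domain G \<and> convex G \<and> bounded G \<longrightarrow> rogosinski_abscissa G \<ge> 1) \<and>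
   (\<forall>G::complex set. is_domain G \<and> convex G \<and> G \<noteq> UNIV \<and> \<not> bounded G \<longrightarrow>
      rogosinski_abscissa_abs G \<ge> 1)"
proof (intro conjI allI impI)
  fix G :: "complex set"
  assume "is_domain G \<and> convex G \<and> bounded G"
  then have "open G" "G \<noteq> {}" "G \<noteq> UNIV"
    using not_bounded_UNIV unfolding is_domain_def by blast+
  then show "rogosinski_abscissa G \<ge> 1"
    by (rule one_le_rogosinski_abscissa)
next
  fix G :: "complex set"
  assume "is_domain G \<and> convex G \<and> G \<noteq> UNIV \<and> \<not> bounded G"
  then show "rogosinski_abscissa_abs G \<ge> 1"
    by (intro one_le_rogosinski_abscissa_abs) (auto simp: is_domain_def)
qed

end
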